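(* For every complex $q$ with $|q|<1$, $$\psi(q)\psi(q^5) = \sum_{n=-\infty}^{\infty} \frac{q^{3n} + q^{7n+1}}{1 - q^{20n+5}} = \sum_{n=-\infty}^{\infty} \frac{q^n + q^{9n+6}}{1 - q^{20n+15}}.$$
   Context: For $|q|<1$, $\psi(q):=\sum_{n=-\infty}^{\infty} q^{2n^2-n}=\sum_{n\ge0}q^{n(n+1)/2}$. *)

theory Defs
  imports "HOL-Analysis.Analysis"
begin

text \<open>Ramanujan's theta function \<open>\<psi>\<close>, meaningful for \<open>norm q < 1\<close>. The exponent
  \<open>2 n\<^sup>2 - n\<close> is a nonnegative integer for every integer \<open>n\<close>, and each triangular number
  \<open>k (k + 1) / 2\<close> with \<open>k \<ge> 0\<close> is attained exactly once.\<close>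

definition psi :: "complex \<Rightarrow> complex" where
  "psi q = (\<Sum>\<^sub>\<infinity>n::int. q powi (2 * n^2 - n))"

text \<open>For bilateral series with exponents of both signs, the point \<open>q = 0\<close> is covered by the
  convention \<open>0 powi k = 0\<close> for \<open>k < 0\<close>. In the terms
  \<open>(q powi (3 * n) + q powi (7 * n + 1)) / (1 - q powi (20 * n + 5))\<close> and
  \<open>(q powi n + q powi (9 * n + 6)) / (1 - q powi (20 * n + 15))\<close> this gives, for every \<open>n\<close>, the
  same value at \<open>q = 0\<close> as continuous extension; the denominators never vanish for
  \<open>norm q < 1\<close>.\<close>

end

theory Submission
  imports Defs
begin

text \<open>Both identities are instances of Kronecker's formula
  \<open>(\<Sum>n. x^n / (1 - a Q^n)) = (Q; Q)^3 \<theta>(a x) / (\<theta>(a) \<theta>(x))\<close> with \<open>Q = q^20\<close> and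
  \<open>\<theta>(z) = (z; Q) (Q/z; Q) (Q; Q)\<close>. By the Jacobi triple product, \<open>\<theta>\<close> is a Laurent series, and in its
  product with the Lambert series the coefficient \<open>c m\<close> of \<open>x^m\<close> satisfies \<open>c (m + 1) = - a Q^m c m\<close>.
  Hence the product is \<open>c 0 \<theta>(a x)\<close>, and \<open>x \<rightarrow> 1\<close> gives \<open>c 0 \<theta>(a) = (Q; Q)^3\<close>.

  The two Lambert series in each identity share \<open>a\<close>, so they add up to a multiple of
  \<open>\<theta>(q^7) + q \<theta>(q^3)\<close>, respectively \<open>\<theta>(q^9) - q^2 \<theta>(q)\<close>. These are the even and odd parts of a single
  theta series of base \<open>- q^5\<close>, so the triple product turns each sum into a product, which is then
  compared with the one for \<open>\<psi>(q) \<psi>(q^5)\<close>.\<close>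

subsection \<open>Infinite products and theta terms\<close>

text \<open>The infinite q-Pochhammer symbol \<open>(z; Q)\<close>.\<close>

definition qprod :: "complex \<Rightarrow> complex \<Rightarrow> complex" where
  "qprod z Q = (\<Prod>k. 1 - z * Q ^ k)"

definition theta_term :: "complex \<Rightarrow> complex \<Rightarrow> int \<Rightarrow> complex" where
  "theta_term Q z n = Q powi (n * (n - 1) div 2) * (- z) powi n"

definition theta :: "complex \<Rightarrow> complex \<Rightarrow> complex" where
  "theta Q z = qprod z Q * qprod (Q / z) Q * qprod Q Q"

lemma convergent_qprod:
  fixes z Q :: complex
  assumes "norm Q < 1"
  shows "convergent_prod (\<lambda>k. 1 - z * Q ^ k)"
proof -
  have "summable (\<lambda>i. norm z * norm Q ^ i)"
    using assms by (intro summable_mult summable_geometric) auto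
  then have "summable (\<lambda>i. norm (1 - z * Q ^ i - 1))"
    by (simp add: norm_mult norm_power)
  then show ?thesis
    by (intro abs_convergent_prod_imp_convergent_prod summable_imp_abs_convergent_prod)
qed

lemma qprod_LIMSEQ:
  assumes "norm Q < 1"
  shows "(\<lambda>n. \<Prod>k<n. 1 - z * Q ^ k) \<longlonglongrightarrow> qprod z Q"
  using convergent_prod_LIMSEQ[OF convergent_qprod[OF assms, of z]]
  unfolding qprod_def LIMSEQ_lessThan_iff_atMost .

lemma qprod_nonzero:
  assumes "norm Q < 1" "\<And>k. z * Q ^ k \<noteq> 1"
  shows "qprod z Q \<noteq> 0"
  unfolding qprod_def
  by (rule prodinf_nonzero[OF convergent_qprod[OF assms(1)]]) (use assms(2) in auto)

lemma qprod_nonzero_norm: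
  assumes "norm Q < 1" "norm z < 1"
  shows "qprod z Q \<noteq> 0"
proof (rule qprod_nonzero[OF assms(1)])
  fix k
  have "norm (z * Q ^ k) \<le> norm z"
    using assms by (auto simp: norm_mult norm_power mult_left_le power_le_one)
  also have "\<dots> < 1" by fact
  finally show "z * Q ^ k \<noteq> 1" by auto
qed

lemma qprod_rec:
  assumes "norm Q < 1"
  shows "qprod z Q = (1 - z) * qprod (z * Q) Q"
proof (rule LIMSEQ_unique)
  show "(\<lambda>n. \<Prod>k<Suc n. 1 - z * Q ^ k) \<longlonglongrightarrow> qprod z Q"
    using qprod_LIMSEQ[OF assms] by (rule LIMSEQ_Suc)
  have "(\<lambda>n. (1 - z) * (\<Prod>k<n. 1 - z * Q * Q ^ k)) \<longlonglongrightarrow> (1 - z) * qprod (z * Q) Q"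
    by (intro tendsto_intros qprod_LIMSEQ assms)
  then show "(\<lambda>n. \<Prod>k<Suc n. 1 - z * Q ^ k) \<longlonglongrightarrow> (1 - z) * qprod (z * Q) Q"
    unfolding prod.lessThan_Suc_shift by (simp add: mult.assoc)
qed

text \<open>Sort the exponents by residue modulo \<open>m\<close>. The full product converges, so
  its partial products of length \<open>n * m\<close> have the same limit, and these regroup as
  finite products.\<close>

lemma qprod_dissect:
  assumes "norm Q < 1" "m > 0"
  shows "qprod z Q = (\<Prod>i<m. qprod (z * Q ^ i) (Q ^ m))"
proof (rule LIMSEQ_unique)
  have "strict_mono (\<lambda>n. n * m)"
    using assms by (auto simp: strict_mono_def)
  from LIMSEQ_subseq_LIMSEQ[OF qprod_LIMSEQ[OF assms(1), of z] this]
  show "(\<lambda>n. \<Prod>k<n*m. 1 - z * Q ^ k) \<longlonglongrightarrow> qprod z Q"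
    by (simp add: o_def)
  have "norm (Q ^ m) < 1"
    using assms by (simp add: norm_power power_less_one_iff)
  then have "(\<lambda>n. \<Prod>i<m. \<Prod>k<n. 1 - z * Q ^ i * (Q ^ m) ^ k) \<longlonglongrightarrow> (\<Prod>i<m. qprod (z * Q ^ i) (Q ^ m))"
    by (intro tendsto_intros qprod_LIMSEQ)
  also have "(\<lambda>n. \<Prod>i<m. \<Prod>k<n. 1 - z * Q ^ i * (Q ^ m) ^ k) = (\<lambda>n. \<Prod>k<n*m. 1 - z * Q ^ k)"
  proof
    fix n
    have "(\<Prod>k<n*m. 1 - z * Q ^ k) = (\<Prod>k<n. \<Prod>j=k*m..<k*m+m. 1 - z * Q ^ j)"
      by (rule prod.nat_group [symmetric])
    also have "\<dots> = (\<Prod>k<n. \<Prod>i<m. 1 - z * Q ^ (i + k * m))"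
    proof (rule prod.cong)
      show "(\<Prod>j=k*m..<k*m+m. 1 - z * Q ^ j) = (\<Prod>i<m. 1 - z * Q ^ (i + k * m))" for k
        using prod.shift_bounds_nat_ivl[of "\<lambda>j. 1 - z * Q ^ j" 0 "k * m" m]
        by (simp add: lessThan_atLeast0 add.commute)
    qed simp
    also have "\<dots> = (\<Prod>i<m. \<Prod>k<n. 1 - z * Q ^ (i + k * m))"
      by (rule prod.swap)
    also have "\<dots> = (\<Prod>i<m. \<Prod>k<n. 1 - z * Q ^ i * (Q ^ m) ^ k)"
      by (simp add: power_add power_mult[symmetric] mult_ac)
    finally show "(\<Prod>i<m. \<Prod>k<n. 1 - z * Q ^ i * (Q ^ m) ^ k) = (\<Prod>k<n*m. 1 - z * Q ^ k)" ..
  qed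
  finally show "(\<lambda>n. \<Prod>k<n*m. 1 - z * Q ^ k) \<longlonglongrightarrow> (\<Prod>i<m. qprod (z * Q ^ i) (Q ^ m))" .
qed

text \<open>Factorwise difference of squares. It trades products at negative arguments for products
  in the squared base.\<close>

lemma qprod_mult_minus:
  assumes "norm Q < 1"
  shows "qprod z Q * qprod (- z) Q = qprod (z\<^sup>2) (Q\<^sup>2)"
proof (rule LIMSEQ_unique)
  have "norm (Q\<^sup>2) < 1"
    using assms by (simp add: norm_power power_less_one_iff)
  then show "(\<lambda>n. \<Prod>k<n. 1 - z\<^sup>2 * (Q\<^sup>2) ^ k) \<longlonglongrightarrow> qprod (z\<^sup>2) (Q\<^sup>2)"
    by (rule qprod_LIMSEQ)
  have "(\<lambda>n. (\<Prod>k<n. 1 - z * Q ^ k) * (\<Prod>k<n. 1 - (-z) * Q ^ k)) \<longlonglongrightarrow> qprod z Q * qprod (-z) Q"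
    by (intro tendsto_intros qprod_LIMSEQ assms)
  also have "(\<lambda>n. (\<Prod>k<n. 1 - z * Q ^ k) * (\<Prod>k<n. 1 - (-z) * Q ^ k)) =
      (\<lambda>n. \<Prod>k<n. 1 - z\<^sup>2 * (Q\<^sup>2) ^ k)"
    unfolding prod.distrib [symmetric]
    by (intro ext prod.cong refl) (simp add: square_diff_one_factored power2_eq_square power_mult_distrib algebra_simps)
  finally show "(\<lambda>n. \<Prod>k<n. 1 - z\<^sup>2 * (Q\<^sup>2) ^ k) \<longlonglongrightarrow> qprod z Q * qprod (-z) Q" .
qed

text \<open>The partial products converge uniformly on a closed disc with \<open>z\<close> in its
  interior, by comparison with a geometric series. The limit \<open>x\<close> to 1 in Kronecker's
  formula relies on this continuity.\<close>

lemma isCont_qprod: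
  assumes "norm Q < 1"
  shows "isCont (\<lambda>z. qprod z Q) z"
proof -
  define A where "A = cball (0::complex) (norm z + 1)"
  have "uniformly_convergent_on A (\<lambda>N x. \<Sum>n<N. norm (- x * Q ^ n))"
  proof (rule Weierstrass_m_test'_ev)
    show "\<forall>\<^sub>F n in sequentially. \<forall>x\<in>A. norm (norm (- x * Q ^ n)) \<le> (norm z + 1) * norm Q ^ n"
      by (auto simp: A_def norm_mult norm_power intro!: mult_right_mono always_eventually)
    show "summable (\<lambda>n. (norm z + 1) * norm Q ^ n)"
      using assms by (intro summable_mult summable_geometric) auto
  qed
  then have "uniformly_convergent_on A (\<lambda>N x. \<Prod>n<N. 1 + (- x * Q ^ n))"
    by (intro uniformly_convergent_on_prod) (auto simp: A_def intro!: continuous_intros)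
  then obtain l where l: "uniform_limit A (\<lambda>N x. \<Prod>n<N. 1 + (- x * Q ^ n)) l sequentially"
    unfolding uniformly_convergent_on_def by blast
  have "continuous_on A l"
    by (rule uniform_limit_theorem[OF always_eventually l]) (intro allI continuous_intros, simp)
  moreover have "l x = qprod x Q" if "x \<in> A" for x
    using LIMSEQ_unique[OF tendsto_uniform_limitI[OF l that]] qprod_LIMSEQ[OF assms, of x] by simp
  ultimately have "continuous_on A (\<lambda>z. qprod z Q)"
    by (rule continuous_on_eq)
  then have "continuous_on (ball 0 (norm z + 1)) (\<lambda>z. qprod z Q)"
    by (rule continuous_on_subset) (auto simp: A_def)
  then show ?thesis
    by (simp add: continuous_on_eq_continuous_at)
qed

section \<open>Theta terms: recurrences and absolute summability\<close>

lemma theta_term_0 [simp]: "theta_term Q z 0 = 1"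
  by (simp add: theta_term_def)

lemma theta_term_Suc:
  assumes "Q \<noteq> 0" "z \<noteq> 0"
  shows "theta_term Q z (n + 1) = - z * Q powi n * theta_term Q z n"
proof -
  have "(n + 1) * (n + 1 - 1) = n * (n - 1) + n * 2"
    by (simp add: algebra_simps)
  then have e: "(n + 1) * (n + 1 - 1) div 2 = n + n * (n - 1) div 2"
    by simp
  show ?thesis
    unfolding theta_term_def e using assms power_int_add[of "- z" n 1] power_int_add[of Q n]
    by simp
qed

lemma theta_term_pred:
  assumes "Q \<noteq> 0" "z \<noteq> 0"
  shows "theta_term Q z (n - 1) = - (Q * Q powi (-n) / z) * theta_term Q z n"
proof -
  have "theta_term Q z n = - z * (Q powi n / Q) * theta_term Q z (n - 1)"
    using theta_term_Suc[OF assms, of "n - 1"] power_int_diff[of Q n 1] assms by simp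
  then show ?thesis
    using assms by (simp add: power_int_minus)
qed

lemma abs_summable_on_int:
  fixes f :: "int \<Rightarrow> 'a :: banach"
  assumes "summable (\<lambda>n. norm (f (int n)))" "summable (\<lambda>n. norm (f (- int n)))"
  shows "(\<lambda>n. norm (f n)) summable_on UNIV"
proof -
  have "(\<lambda>n. norm (f n)) summable_on (int ` UNIV)"
    using norm_summable_imp_summable_on[of "\<lambda>n. norm (f (int n))"] assms(1)
    by (subst summable_on_reindex) (auto simp: o_def)
  moreover have "(\<lambda>n. norm (f n)) summable_on ((\<lambda>n. - int n) ` UNIV)"
    using norm_summable_imp_summable_on[of "\<lambda>n. norm (f (- int n))"] assms(2)
    by (subst summable_on_reindex) (auto simp: o_def inj_def)
  ultimately have "(\<lambda>n. norm (f n)) summable_on (int ` UNIV \<union> (\<lambda>n. - int n) ` UNIV)"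
    by (rule summable_on_union)
  also have "int ` UNIV \<union> (\<lambda>n. - int n) ` UNIV = UNIV"
  proof -
    have "n \<in> int ` UNIV \<union> (\<lambda>n. - int n) ` UNIV" for n
      by (cases n rule: int_cases2) auto
    then show ?thesis by blast
  qed
  finally show ?thesis .
qed

text \<open>The ratio \<open>C * norm Q ^ n\<close> of successive norms tends to 0 and so ends up
  below \<open>1/2\<close>. Theta terms have such ratios along both half-lines.\<close>

lemma summable_superexp:
  fixes f :: "nat \<Rightarrow> 'a :: banach" and Q :: complex
  assumes "norm Q < 1" "\<And>n. norm (f (Suc n)) = C * norm Q ^ n * norm (f n)"
  shows "summable (\<lambda>n. norm (f n))"
proof -
  have "(\<lambda>n. C * norm Q ^ n) \<longlonglongrightarrow> C * 0"
    using assms by (intro tendsto_intros LIMSEQ_power_zero) auto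
  then have "\<forall>\<^sub>F n in sequentially. C * norm Q ^ n < 1/2"
    by (rule order_tendstoD) simp
  then obtain N where N: "\<And>n. n \<ge> N \<Longrightarrow> C * norm Q ^ n < 1/2"
    by (auto simp: eventually_sequentially)
  show ?thesis
  proof (rule summable_ratio_test)
    show "norm (norm (f (Suc n))) \<le> 1/2 * norm (norm (f n))" if "n \<ge> N" for n
    proof -
      have "norm (f (Suc n)) \<le> 1/2 * norm (f n)"
        unfolding assms(2) by (rule mult_right_mono) (use N[OF that] in auto)
      then show ?thesis by simp
    qed
  qed simp
qed

lemma theta_term_abs_summable:
  assumes "Q \<noteq> 0" "norm Q < 1" "z \<noteq> 0"
  shows "(\<lambda>n. norm (theta_term Q z n)) summable_on UNIV"
proof (rule abs_summable_on_int)
  show "summable (\<lambda>n. norm (theta_term Q z (int n)))"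
  proof (rule summable_superexp[where Q = Q and C = "norm z"])
    fix n
    show "norm (theta_term Q z (int (Suc n))) = norm z * norm Q ^ n * norm (theta_term Q z (int n))"
      using theta_term_Suc[OF assms(1,3), of "int n"]
      by (simp add: norm_mult norm_power add.commute)
  qed fact
  show "summable (\<lambda>n. norm (theta_term Q z (- int n)))"
  proof (rule summable_superexp[where Q = Q and C = "norm (Q / z)"])
    fix n
    show "norm (theta_term Q z (- int (Suc n))) = norm (Q / z) * norm Q ^ n * norm (theta_term Q z (- int n))"
    proof -
      have "- int (Suc n) = - int n - 1" by simp
      then show ?thesis
        using theta_term_pred[OF assms(1,3), of "- int n"]
        by (simp only:) (simp add: norm_mult norm_power norm_divide)
    qed
  qed fact
qed

subsection \<open>The Jacobi triple product\<close>

text \<open>Tannery's theorem. The majorant makes the finite partial sums converge uniformly in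
  \<open>n\<close>, so the limit in \<open>n\<close> may be interchanged with the limit over finite
  index sets.\<close>

lemma infsum_dominated_convergence:
  fixes f :: "nat \<Rightarrow> 'a \<Rightarrow> 'b :: banach"
  assumes bound: "\<And>n x. norm (f n x) \<le> M x" and M: "M summable_on UNIV"
    and lim: "\<And>x. (\<lambda>n. f n x) \<longlonglongrightarrow> g x"
  shows "(\<lambda>n. infsum (f n) UNIV) \<longlonglongrightarrow> infsum g UNIV"
proof -
  have bound': "norm (g x) \<le> M x" for x
    by (rule LIMSEQ_le_const2[OF tendsto_norm[OF lim]]) (use bound in auto)
  have g: "g summable_on UNIV"
    using Infinite_Sum.abs_summable_on_comparison_test'[OF M bound'] by (rule Infinite_Sum.abs_summable_summable)
  show "(\<lambda>n. infsum (f n) UNIV) \<longlonglongrightarrow> infsum g UNIV"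
  proof (rule swap_uniform_limit')
    show "uniform_limit UNIV (\<lambda>X n. \<Sum>x\<in>X. f n x) (\<lambda>n. \<Sum>\<^sub>\<infinity>x. f n x) (finite_subsets_at_top UNIV)"
      by (rule Weierstrass_m_test_general[OF _ M]) (rule bound)
    show "(sum g \<longlongrightarrow> infsum g UNIV) (finite_subsets_at_top UNIV)"
      using has_sum_infsum[OF g] by (simp add: has_sum_def)
    show "\<forall>\<^sub>F X in finite_subsets_at_top UNIV. (\<lambda>n. \<Sum>x\<in>X. f n x) \<longlonglongrightarrow> sum g X"
      by (intro always_eventually allI tendsto_sum lim)
  qed auto
qed

section \<open>The finite form of the triple product\<close>

definition qfact :: "complex \<Rightarrow> nat \<Rightarrow> complex" where
  "qfact Q n = (\<Prod>k<n. 1 - Q * Q ^ k)"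

text \<open>Extending the reciprocal by \<open>0\<close> to negative arguments keeps its recurrence valid for
  all integers, so that the finite form of the triple product has no boundary cases.\<close>

definition qfact_recip :: "complex \<Rightarrow> int \<Rightarrow> complex" where
  "qfact_recip Q n = (if n < 0 then 0 else 1 / qfact Q (nat n))"

lemma power_neq_1_norm:
  fixes Q :: complex
  assumes "norm Q < 1"
  shows "Q * Q ^ n \<noteq> 1"
proof
  assume "Q * Q ^ n = 1"
  then have "norm Q ^ Suc n = 1"
    by (metis norm_one norm_power power_Suc)
  moreover have "norm Q ^ Suc n < 1"
    using assms by (subst power_less_one_iff) auto
  ultimately show False by simp
qed

lemma qfact_nonzero: "norm Q < 1 \<Longrightarrow> qfact Q n \<noteq> 0"
  using power_neq_1_norm by (auto simp: qfact_def)

lemma qfact_recip_pred: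
  assumes "Q \<noteq> 0" "norm Q < 1"
  shows "qfact_recip Q (n - 1) = (1 - Q powi n) * qfact_recip Q n"
proof (cases "n \<ge> 1")
  case True
  then obtain m where m: "n = int (Suc m)"
    using zero_less_imp_eq_int[of n] by (metis Suc_pred less_le_trans zero_less_one)
  then have "n - 1 = int m" by simp
  then have "qfact_recip Q (n - 1) = 1 / qfact Q m" "qfact_recip Q n = 1 / qfact Q (Suc m)"
    by (simp_all only: m) (simp_all only: qfact_recip_def nat_int, simp_all)
  moreover have "Q powi n = Q * Q ^ m"
    unfolding m power_int_of_nat by simp
  ultimately show ?thesis
    using power_neq_1_norm[OF assms(2), of m] qfact_nonzero[OF assms(2), of m]
    by (simp add: qfact_def)
next
  case False
  then show ?thesis
    by (cases "n = 0") (auto simp: qfact_recip_def)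
qed

text \<open>The factor in front of the theta term is the Gaussian binomial coefficient of
  \<open>2 * N\<close> over \<open>N + n\<close>, which vanishes for
  \<open>abs n > N\<close>.\<close>

definition finite_theta_term :: "complex \<Rightarrow> complex \<Rightarrow> nat \<Rightarrow> int \<Rightarrow> complex" where
  "finite_theta_term Q z N n =
     qfact Q (2 * N) * qfact_recip Q (int N + n) * qfact_recip Q (int N - n) * theta_term Q z n"

text \<open>This is the coefficientwise effect of multiplying by the next two factors, \<open>(1 - z
  * Q^N) * (1 - Q / z * Q^N) = 1 + Q^(2 * N + 1) - z * Q^N - Q^(N + 1) / z\<close>, where
  \<open>z\<close> and \<open>1 / z\<close> shift the index by one.\<close>

lemma finite_theta_term_Suc:
  assumes Q: "Q \<noteq> 0" "norm Q < 1" and z: "z \<noteq> 0"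
  shows "finite_theta_term Q z (Suc N) n =
    (1 + Q ^ (2 * N + 1)) * finite_theta_term Q z N n
    - z * Q ^ N * finite_theta_term Q z N (n - 1)
    - Q ^ (N + 1) / z * finite_theta_term Q z N (n + 1)"
proof -
  \<comment> \<open>All four terms are expressed through \<open>\<alpha> = Q powi A\<close> and
    \<open>\<delta> = Q powi D\<close>: their indices differ from \<open>A\<close> and
    \<open>D\<close> by at most 2, and \<open>\<alpha> * \<delta>\<close> is independent of
    \<open>n\<close>.\<close>
  define A D where "A = int N + 1 + n" and "D = int N + 1 - n"
  define \<alpha> \<delta> where "\<alpha> = Q powi A" and "\<delta> = Q powi D"
  define a d where "a = qfact_recip Q A" and "d = qfact_recip Q D"
  note pred = qfact_recip_pred[OF Q]
  have p1: "Q powi (A - 1) = \<alpha> / Q" "Q powi (D - 1) = \<delta> / Q"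
    using Q by (simp_all add: \<alpha>_def \<delta>_def power_int_diff)
  have a1: "qfact_recip Q (A - 1) = (1 - \<alpha>) * a" and d1: "qfact_recip Q (D - 1) = (1 - \<delta>) * d"
    by (simp_all add: pred \<alpha>_def \<delta>_def a_def d_def)
  have a2: "qfact_recip Q (A - 2) = (1 - \<alpha> / Q) * (1 - \<alpha>) * a"
    using pred[of "A - 1"] by (simp add: a1 p1)
  have d2: "qfact_recip Q (D - 2) = (1 - \<delta> / Q) * (1 - \<delta>) * d"
    using pred[of "D - 1"] by (simp add: d1 p1)
  have \<alpha>\<delta>: "\<alpha> * \<delta> = Q ^ (2 * N + 2)"
  proof -
    have "\<alpha> * \<delta> = Q powi (A + D)"
      using Q by (simp add: \<alpha>_def \<delta>_def power_int_add)
    also have "A + D = int (2 * N + 2)"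
      by (simp add: A_def D_def)
    finally show ?thesis
      unfolding power_int_of_nat .
  qed
  have t1: "z * Q ^ N * theta_term Q z (n - 1) = - \<delta> * theta_term Q z n"
  proof -
    have "\<delta> = Q ^ N * (Q * Q powi (- n))"
    proof -
      have "D = int N + 1 + (- n)" by (simp add: D_def)
      then show ?thesis
        using Q power_int_add[of Q "int N + 1" "- n"] by (simp add: \<delta>_def power_int_add)
    qed
    then show ?thesis
      using z by (simp add: theta_term_pred[OF Q(1) z])
  qed
  have t2: "Q ^ (N + 1) / z * theta_term Q z (n + 1) = - \<alpha> * theta_term Q z n"
  proof -
    have "\<alpha> = Q ^ (N + 1) * Q powi n"
      using Q by (simp add: \<alpha>_def A_def power_int_add)
    then show ?thesis
      using z by (simp add: theta_term_Suc[OF Q(1) z])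
  qed
  have f: "qfact Q (2 * Suc N) = qfact Q (2 * N) * (1 - \<alpha> * \<delta> / Q) * (1 - \<alpha> * \<delta>)"
    using Q unfolding \<alpha>\<delta> by (simp add: qfact_def mult.assoc)
  define e where "e = qfact Q (2 * N) * theta_term Q z n"
  have i: "int (Suc N) + n = A" "int (Suc N) - n = D" "int N + n = A - 1" "int N - n = D - 1"
    "int N + (n - 1) = A - 2" "int N - (n - 1) = D" "int N + (n + 1) = A" "int N - (n + 1) = D - 2"
    by (simp_all add: A_def D_def)
  have "finite_theta_term Q z (Suc N) n = e * a * d * ((1 - \<alpha> * \<delta> / Q) * (1 - \<alpha> * \<delta>))"
    unfolding finite_theta_term_def i f by (simp add: a_def d_def e_def mult_ac)
  \<comment> \<open>Once \<open>e * a * d\<close> is factored out, the recurrence is this polynomial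
    identity in \<open>\<alpha>\<close>, \<open>\<delta>\<close> and \<open>1 / Q\<close>. The three
    summands on the right belong to the indices \<open>n\<close>, \<open>n - 1\<close> and
    \<open>n + 1\<close>.\<close>
  also have "(1 - \<alpha> * \<delta> / Q) * (1 - \<alpha> * \<delta>) =
    (1 + \<alpha> * \<delta> / Q) * (1 - \<alpha>) * (1 - \<delta>) + \<delta> * (1 - \<alpha> / Q) * (1 - \<alpha>) + \<alpha> * (1 - \<delta> / Q) * (1 - \<delta>)"
    using Q by (simp add: field_simps)
  also have "e * a * d * \<dots> = (1 + \<alpha> * \<delta> / Q) * finite_theta_term Q z N n
    - z * Q ^ N * finite_theta_term Q z N (n - 1)
    - Q ^ (N + 1) / z * finite_theta_term Q z N (n + 1)"
  proof -
    have "z * Q ^ N * finite_theta_term Q z N (n - 1) =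
       qfact Q (2 * N) * qfact_recip Q (A - 2) * qfact_recip Q D * (z * Q ^ N * theta_term Q z (n - 1))"
      unfolding finite_theta_term_def i by (simp only: mult_ac)
    also have "\<dots> = - \<delta> * (1 - \<alpha> / Q) * (1 - \<alpha>) * (e * a * d)"
      unfolding t1 a2 d_def [symmetric] e_def by (simp only: mult_ac mult_minus_left mult_minus_right)
    finally have 1: "z * Q ^ N * finite_theta_term Q z N (n - 1) = \<dots>" .
    have "Q ^ (N + 1) / z * finite_theta_term Q z N (n + 1) =
       qfact Q (2 * N) * qfact_recip Q A * qfact_recip Q (D - 2) * (Q ^ (N + 1) / z * theta_term Q z (n + 1))"
      unfolding finite_theta_term_def i by (simp only: mult_ac)
    also have "\<dots> = - \<alpha> * (1 - \<delta> / Q) * (1 - \<delta>) * (e * a * d)"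
      unfolding t2 d2 a_def [symmetric] e_def by (simp only: mult_ac mult_minus_left mult_minus_right)
    finally have 2: "Q ^ (N + 1) / z * finite_theta_term Q z N (n + 1) = \<dots>" .
    have 3: "finite_theta_term Q z N n = (1 - \<alpha>) * (1 - \<delta>) * (e * a * d)"
      unfolding finite_theta_term_def i a1 d1 e_def by (simp only: mult_ac)
    show ?thesis
      unfolding 1 2 3 using Q by (simp add: field_simps)
  qed
  also have "\<alpha> * \<delta> / Q = Q ^ (2 * N + 1)"
    using Q unfolding \<alpha>\<delta> by simp
  finally show ?thesis .
qed

lemma has_sum_int_shift:
  fixes f :: "int \<Rightarrow> 'a :: {comm_monoid_add, topological_space}"
  shows "((\<lambda>n. f (n + k)) has_sum s) UNIV \<longleftrightarrow> (f has_sum s) UNIV"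
  by (rule has_sum_reindex_bij_witness[of _ "\<lambda>n. n - k" "\<lambda>n. n + k"]) auto

text \<open>Induction on \<open>N\<close>. Shifting the index leaves a bilateral sum unchanged, so
  the recurrence multiplies the sum by exactly the two new factors.\<close>

lemma finite_theta_has_sum:
  assumes Q: "Q \<noteq> 0" "norm Q < 1" and z: "z \<noteq> 0"
  shows "(finite_theta_term Q z N has_sum (\<Prod>k<N. 1 - z * Q ^ k) * (\<Prod>k<N. 1 - Q / z * Q ^ k)) UNIV"
proof (induction N)
  case 0
  have "(finite_theta_term Q z 0 has_sum 1) UNIV"
    by (rule has_sum_finite_neutralI[of "{0}"])
      (auto simp: finite_theta_term_def qfact_recip_def qfact_def)
  then show ?case by simp
next
  case (Suc N)
  define S where "S = (\<Prod>k<N. 1 - z * Q ^ k) * (\<Prod>k<N. 1 - Q / z * Q ^ k)"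
  let ?f = "finite_theta_term Q z N"
  have "((\<lambda>n. (1 + Q ^ (2 * N + 1)) * ?f n + (- (z * Q ^ N)) * ?f (n + - 1) + (- (Q ^ (N + 1) / z)) * ?f (n + 1))
    has_sum ((1 + Q ^ (2 * N + 1)) * S + (- (z * Q ^ N)) * S + (- (Q ^ (N + 1) / z)) * S)) UNIV"
    using Suc.IH unfolding S_def [symmetric]
    by (intro has_sum_add has_sum_cmult_right) (simp_all only: has_sum_int_shift)
  moreover have "(\<lambda>n. (1 + Q ^ (2 * N + 1)) * ?f n + (- (z * Q ^ N)) * ?f (n + - 1) + (- (Q ^ (N + 1) / z)) * ?f (n + 1))
    = finite_theta_term Q z (Suc N)"
    by (simp add: fun_eq_iff finite_theta_term_Suc[OF assms])
  moreover have "(1 + Q ^ (2 * N + 1)) * S + (- (z * Q ^ N)) * S + (- (Q ^ (N + 1) / z)) * S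
    = (\<Prod>k<Suc N. 1 - z * Q ^ k) * (\<Prod>k<Suc N. 1 - Q / z * Q ^ k)"
  proof -
    have "(1 + Q ^ (2 * N + 1)) * S + (- (z * Q ^ N)) * S + (- (Q ^ (N + 1) / z)) * S
      = S * ((1 - z * Q ^ N) * (1 - Q / z * Q ^ N))"
      using z by (simp add: field_simps power_mult power2_eq_square)
    then show ?thesis by (simp add: S_def mult_ac)
  qed
  ultimately show ?case by simp
qed

text \<open>Let \<open>N\<close> tend to infinity in the finite form. The Gaussian binomials tend to
  \<open>1 / J\<close> and are bounded independently of \<open>N\<close> and \<open>n\<close>, so a
  multiple of the theta terms is a majorant and the limit can be taken termwise.\<close>

lemma has_sum_theta:
  assumes Q: "Q \<noteq> 0" "norm Q < 1" and z: "z \<noteq> 0"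
  shows "(theta_term Q z has_sum theta Q z) UNIV"
proof -
  define J where "J = qprod Q Q"
  have J: "J \<noteq> 0"
    unfolding J_def by (rule qprod_nonzero_norm) fact+
  have lim: "(\<lambda>n. qfact Q n) \<longlonglongrightarrow> J"
    unfolding qfact_def J_def by (rule qprod_LIMSEQ) fact
  then have lim': "(\<lambda>n. 1 / qfact Q n) \<longlonglongrightarrow> 1 / J"
    by (intro tendsto_intros J)
  obtain R where R: "R > 0" "\<And>n. norm (qfact Q n) \<le> R"
    using convergent_imp_Bseq[OF convergentI[OF lim]] by (auto elim!: BseqE)
  obtain R' where R': "R' > 0" "\<And>n. norm (1 / qfact Q n) \<le> R'"
    using convergent_imp_Bseq[OF convergentI[OF lim']] by (auto elim!: BseqE)
  have R'': "norm (qfact_recip Q n) \<le> R'" for n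
    using R' by (auto simp: qfact_recip_def)
  have M: "(\<lambda>n. R * R' * R' * norm (theta_term Q z n)) summable_on UNIV"
    by (intro summable_on_cmult_right theta_term_abs_summable assms)
  have bound: "norm (finite_theta_term Q z N n) \<le> R * R' * R' * norm (theta_term Q z n)" for N n
    unfolding finite_theta_term_def norm_mult
    using R(1) R'(1) by (intro mult_mono R R'') auto
  have pointwise: "(\<lambda>N. finite_theta_term Q z N n) \<longlonglongrightarrow> J * (1 / J) * (1 / J) * theta_term Q z n" for n
    unfolding finite_theta_term_def
  proof (intro tendsto_intros)
    show "(\<lambda>N. qfact Q (2 * N)) \<longlonglongrightarrow> J"
      using LIMSEQ_subseq_LIMSEQ[OF lim, of "\<lambda>N. 2 * N"] by (simp add: o_def strict_mono_def)
    \<comment> \<open>For fixed \<open>m\<close> the argument is eventually nonnegative, so the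
      default value 0 does not affect the limit.\<close>
    have *: "(\<lambda>N. qfact_recip Q (int N + m)) \<longlonglongrightarrow> 1 / J" for m
    proof (rule Lim_transform_eventually)
      have "filterlim (\<lambda>N. nat (int N + m)) at_top at_top"
        unfolding filterlim_at_top
      proof
        fix Z
        show "\<forall>\<^sub>F N in sequentially. Z \<le> nat (int N + m)"
          using eventually_ge_at_top[of "nat (int Z - m)"] by eventually_elim auto
      qed
      then show "(\<lambda>N. 1 / qfact Q (nat (int N + m))) \<longlonglongrightarrow> 1 / J"
        by (rule filterlim_compose[OF lim'])
      show "\<forall>\<^sub>F N in sequentially. 1 / qfact Q (nat (int N + m)) = qfact_recip Q (int N + m)"
        using eventually_ge_at_top[of "nat (- m)"] by eventually_elim (auto simp: qfact_recip_def)
    qed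
    show "(\<lambda>N. qfact_recip Q (int N + n)) \<longlonglongrightarrow> 1 / J" by (rule *)
    show "(\<lambda>N. qfact_recip Q (int N - n)) \<longlonglongrightarrow> 1 / J" using *[of "- n"] by simp
  qed
  have "(\<lambda>N. infsum (finite_theta_term Q z N) UNIV) \<longlonglongrightarrow> (\<Sum>\<^sub>\<infinity>n. J * (1 / J) * (1 / J) * theta_term Q z n)"
    by (rule infsum_dominated_convergence[OF bound M pointwise])
  also have "(\<lambda>N. infsum (finite_theta_term Q z N) UNIV)
      = (\<lambda>N. (\<Prod>k<N. 1 - z * Q ^ k) * (\<Prod>k<N. 1 - Q / z * Q ^ k))"
    by (intro ext infsumI finite_theta_has_sum assms)
  finally have *: "(\<Sum>\<^sub>\<infinity>n. J * (1 / J) * (1 / J) * theta_term Q z n) = qprod z Q * qprod (Q / z) Q"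
    by (rule LIMSEQ_unique) (intro tendsto_mult qprod_LIMSEQ Q)
  note * [symmetric]
  also have "(\<Sum>\<^sub>\<infinity>n. J * (1 / J) * (1 / J) * theta_term Q z n) = J * (1 / J) * (1 / J) * infsum (theta_term Q z) UNIV"
    by (rule infsum_cmult_right')
  finally have "infsum (theta_term Q z) UNIV = theta Q z"
    using J by (simp add: theta_def J_def [symmetric] field_simps)
  then show ?thesis
    using Infinite_Sum.abs_summable_summable[OF theta_term_abs_summable[OF assms]] by (simp add: has_sum_iff)
qed

subsection \<open>Kronecker's Lambert series\<close>

lemma has_sum_times:
  fixes f g :: "'a \<Rightarrow> complex"
  assumes f: "(f has_sum s) A" "(\<lambda>x. norm (f x)) summable_on A"
    and g: "(g has_sum t) B" "(\<lambda>x. norm (g x)) summable_on B"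
  shows "((\<lambda>(x, y). f x * g y) has_sum s * t) (A \<times> B)"
proof (rule has_sum_SigmaI)
  show "((\<lambda>y. case (x, y) of (x, y) \<Rightarrow> f x * g y) has_sum f x * t) B" for x
    using has_sum_cmult_right[OF g(1)] by simp
  show "((\<lambda>x. f x * t) has_sum s * t) A"
    using has_sum_cmult_left[OF f(1)] by simp
  have "(\<lambda>x. norm (f x) * (\<Sum>\<^sub>\<infinity>y\<in>B. norm (g y))) summable_on A"
    by (intro summable_on_cmult_left f)
  then have "(\<lambda>(x, y). norm (f x) * norm (g y)) summable_on A \<times> B"
    by (intro summable_on_SigmaI[where g = "\<lambda>x. norm (f x) * (\<Sum>\<^sub>\<infinity>y\<in>B. norm (g y))"])
      (auto intro!: has_sum_cmult_right has_sum_infsum g)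
  then have "(\<lambda>p. norm (case p of (x, y) \<Rightarrow> f x * g y)) summable_on A \<times> B"
    by (simp add: case_prod_unfold norm_mult)
  then show "(\<lambda>(x, y). f x * g y) summable_on A \<times> B"
    by (rule Infinite_Sum.abs_summable_summable)
qed

section \<open>Estimates for the Lambert series\<close>

definition lambert_term :: "complex \<Rightarrow> complex \<Rightarrow> complex \<Rightarrow> int \<Rightarrow> complex" where
  "lambert_term Q a x n = x powi n / (1 - a * Q powi n)"

text \<open>For \<open>n >= 0\<close> the norm of \<open>a * Q powi n\<close> is at most
  \<open>norm a < 1\<close>. For \<open>n < 0\<close>, pulling out \<open>Q powi n\<close> leaves
  \<open>Q powi (- n) - a\<close>, and \<open>Q powi (- n)\<close> has norm at most
  \<open>norm Q < norm a\<close>.\<close>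

lemma lambert_denom_lower_bound:
  fixes a Q :: complex
  assumes "norm Q < norm a" "norm a < 1" "Q \<noteq> 0"
  obtains \<delta> where "\<delta> > 0" "\<And>n. n \<ge> 0 \<Longrightarrow> norm (1 - a * Q powi n) \<ge> \<delta>"
    "\<And>n. n < 0 \<Longrightarrow> norm (1 - a * Q powi n) \<ge> \<delta> * norm Q powi n"
proof
  define \<delta> where "\<delta> = min (1 - norm a) (norm a - norm Q)"
  show "\<delta> > 0"
    using assms by (simp add: \<delta>_def)
  have Q1: "norm Q \<le> 1" using assms by simp
  show "norm (1 - a * Q powi n) \<ge> \<delta>" if "n \<ge> 0" for n
  proof -
    have "norm (a * Q powi n) \<le> norm a"
      using that Q1 by (simp add: norm_mult power_int_nonneg_exp norm_power mult_left_le power_le_one)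
    then show ?thesis
      using norm_triangle_ineq2[of 1 "a * Q powi n"] by (simp add: \<delta>_def)
  qed
  show "norm (1 - a * Q powi n) \<ge> \<delta> * norm Q powi n" if "n < 0" for n
  proof -
    obtain k where n: "n = - int (Suc k)"
      using negD \<open>n < 0\<close> by blast
    have "norm (Q ^ Suc k) \<le> norm Q"
      using Q1 by (simp add: norm_mult norm_power mult_left_le power_le_one)
    then have "\<delta> \<le> norm (a - Q ^ Suc k)"
      using norm_triangle_ineq2[of a "Q ^ Suc k"] unfolding \<delta>_def by linarith
    also have "\<dots> = norm (Q powi (- n) * (1 - a * Q powi n))"
    proof -
      have "Q powi (- n) = Q ^ Suc k"
        unfolding n minus_minus power_int_of_nat ..
      moreover have "Q powi n * Q powi (- n) = 1"
        using assms(3) by (simp add: power_int_minus)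
      ultimately have "Q powi (- n) * (1 - a * Q powi n) = Q ^ Suc k - a"
        by (simp only: right_diff_distrib) (simp add: mult_ac)
      then show ?thesis by (simp add: norm_minus_commute)
    qed
    also have "\<dots> = norm Q powi (- n) * norm (1 - a * Q powi n)"
      by (simp add: norm_mult norm_power_int)
    finally show ?thesis
      using assms(3) by (simp add: power_int_minus field_simps)
  qed
qed

lemma summable_on_geometric_int:
  fixes w :: real
  assumes "0 \<le> w" "w < 1"
  shows "(\<lambda>n::int. w ^ nat \<bar>n\<bar>) summable_on UNIV"
proof -
  have "(\<lambda>n::int. norm (w ^ nat \<bar>n\<bar>)) summable_on UNIV"
    by (rule abs_summable_on_int) (use assms in \<open>simp_all add: norm_power summable_geometric\<close>)
  then show ?thesis
    using assms by simp
qed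

lemma lambert_denom_nonzero:
  fixes a Q :: complex
  assumes "norm Q < norm a" "norm a < 1" "Q \<noteq> 0"
  shows "1 - a * Q powi n \<noteq> 0"
proof -
  obtain \<delta> where \<delta>: "\<delta> > 0" "\<And>n. n \<ge> 0 \<Longrightarrow> norm (1 - a * Q powi n) \<ge> \<delta>"
    "\<And>n. n < 0 \<Longrightarrow> norm (1 - a * Q powi n) \<ge> \<delta> * norm Q powi n"
    using lambert_denom_lower_bound[OF assms] by blast
  have "norm (1 - a * Q powi n) > 0"
  proof (cases "n \<ge> 0")
    case True
    then show ?thesis using \<delta>(1) \<delta>(2)[OF True] by linarith
  next
    case False
    have "0 < \<delta> * norm Q powi n" using \<delta>(1) assms(3) by (simp add: zero_less_power_int)
    then show ?thesis using \<delta>(3)[of n] False by linarith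
  qed
  then show ?thesis by simp
qed

text \<open>Only the summands with \<open>n \<ge> 0\<close> fail to be dominated uniformly as \<open>x\<close> tends to \<open>1\<close>, and their
  singular part is the geometric series.\<close>

lemma lambert_term_minus_geometric_bound:
  fixes a Q :: complex
  assumes a: "norm Q < norm a" "norm a < 1" "Q \<noteq> 0" and s: "norm Q < s" "s < 1"
  obtains B where "\<And>x n. s \<le> norm x \<Longrightarrow> norm x < 1 \<Longrightarrow>
    norm (lambert_term Q a x n - (if n \<ge> 0 then x powi n else 0)) \<le> B * (norm Q / s) ^ nat \<bar>n\<bar>"
proof -
  obtain \<delta> where \<delta>: "\<delta> > 0" "\<And>n. n \<ge> 0 \<Longrightarrow> norm (1 - a * Q powi n) \<ge> \<delta>"
    "\<And>n. n < 0 \<Longrightarrow> norm (1 - a * Q powi n) \<ge> \<delta> * norm Q powi n"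
    using lambert_denom_lower_bound[OF a] by blast
  have Q0: "norm Q > 0" using a(3) by simp
  have s0: "s > 0" using Q0 s(1) by linarith
  show ?thesis
  proof (rule that[of "1 / \<delta>"])
    fix x :: complex and n :: int
    assume x: "s \<le> norm x" "norm x < 1"
    show "norm (lambert_term Q a x n - (if n \<ge> 0 then x powi n else 0)) \<le> 1 / \<delta> * (norm Q / s) ^ nat \<bar>n\<bar>"
    proof (cases "n \<ge> 0")
      case True
      then obtain m where n: "n = int m" using nonneg_int_cases by blast
      have nz: "1 - a * Q ^ m \<noteq> 0"
        using lambert_denom_nonzero[OF a, of n] by (simp add: n)
      \<comment> \<open>Subtracting the geometric term leaves the extra factor
        \<open>a * Q ^ m\<close>, which gives decay uniformly up to
        \<open>norm x = 1\<close>.\<close>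
      have "lambert_term Q a x n - x powi n = x ^ m * (a * Q ^ m) / (1 - a * Q ^ m)"
        using nz by (simp add: lambert_term_def n field_simps)
      also have "norm \<dots> = (norm x ^ m * norm a) * norm Q ^ m / norm (1 - a * Q ^ m)"
        by (simp add: norm_mult norm_divide norm_power)
      also have "\<dots> \<le> 1 * (norm Q / s) ^ m / \<delta>"
      proof (intro frac_le mult_mono power_mono)
        show "norm x ^ m * norm a \<le> 1"
          using x a by (intro mult_le_one power_le_one) auto
        show "norm Q \<le> norm Q / s"
          using Q0 s s0 by (simp add: field_simps)
        show "\<delta> \<le> norm (1 - a * Q ^ m)"
          using \<delta>(2)[of "int m"] by simp
      qed (use \<delta>(1) s0 in auto)
      finally show ?thesis
        using True by (simp add: n)
    next
      case False
      then obtain m where n: "n = - int m"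
        using negD[of n] by fastforce
      have "norm (lambert_term Q a x n) = norm x powi n / norm (1 - a * Q powi n)"
        by (simp add: lambert_term_def norm_divide norm_power_int)
      \<comment> \<open>At negative indices the numerator grows, but the denominator grows faster
        because \<open>norm Q < s\<close>.\<close>
      also have "\<dots> \<le> s powi n / (\<delta> * norm Q powi n)"
      proof (intro frac_le)
        show "norm x powi n \<le> s powi n"
          using x s0 by (simp add: n power_int_minus le_imp_inverse_le power_mono)
        show "\<delta> * norm Q powi n \<le> norm (1 - a * Q powi n)"
          using \<delta>(3) False by simp
      qed (use \<delta>(1) Q0 s0 in \<open>auto simp: zero_less_power_int\<close>)
      also have "\<dots> = 1 / \<delta> * (norm Q / s) ^ m"
        using Q0 s0 by (simp add: n power_int_minus power_divide field_simps)
      finally show ?thesis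
        using False by (simp add: n)
    qed
  qed
qed

lemma has_sum_geometric_int:
  fixes x :: complex
  assumes "norm x < 1"
  shows "((\<lambda>n. if n \<ge> 0 then x powi n else 0) has_sum 1 / (1 - x)) (UNIV :: int set)"
proof -
  have "((\<lambda>n. x ^ n) has_sum 1 / (1 - x)) UNIV"
    using assms by (intro norm_summable_imp_has_sum geometric_sums) (auto simp: norm_power summable_geometric)
  also have "?this \<longleftrightarrow> ((\<lambda>n. x powi n) has_sum 1 / (1 - x)) {0::int..}"
    by (rule has_sum_reindex_bij_witness[of _ nat int]) auto
  also have "\<dots> \<longleftrightarrow> ((\<lambda>n. if n \<ge> 0 then x powi n else 0) has_sum 1 / (1 - x)) (UNIV :: int set)"
    by (rule has_sum_cong_neutral) auto
  finally show ?thesis .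
qed

lemma geometric_int_abs_summable:
  fixes x :: complex
  assumes "norm x < 1"
  shows "(\<lambda>n::int. norm (if n \<ge> 0 then x powi n else 0)) summable_on UNIV"
  by (rule Infinite_Sum.abs_summable_on_comparison_test'[OF summable_on_geometric_int[of "norm x"]])
    (use assms in \<open>auto simp: norm_power power_int_nonneg_exp\<close>)

lemma lambert_term_abs_summable:
  fixes a Q x :: complex
  assumes a: "norm Q < norm a" "norm a < 1" "Q \<noteq> 0" and x: "norm Q < norm x" "norm x < 1"
  shows "(\<lambda>n. norm (lambert_term Q a x n)) summable_on UNIV"
proof -
  let ?g = "\<lambda>n::int. if n \<ge> 0 then x powi n else 0"
  \<comment> \<open>The uniform bound is applied with \<open>s = norm x\<close>.\<close>
  obtain B where B: "\<And>n. norm (lambert_term Q a x n - ?g n) \<le> B * (norm Q / norm x) ^ nat \<bar>n\<bar>"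
    using lambert_term_minus_geometric_bound[OF a x] x by (metis order_refl)
  have "norm x > 0"
    using x(1) norm_ge_zero[of Q] by linarith
  then have "(\<lambda>n. B * (norm Q / norm x) ^ nat \<bar>n\<bar> + norm (?g n)) summable_on UNIV"
    using x by (intro summable_on_add summable_on_cmult_right summable_on_geometric_int geometric_int_abs_summable) auto
  then show ?thesis
  proof (rule Infinite_Sum.abs_summable_on_comparison_test')
    show "norm (lambert_term Q a x n) \<le> B * (norm Q / norm x) ^ nat \<bar>n\<bar> + norm (?g n)" for n
      using norm_triangle_ineq[of "lambert_term Q a x n - ?g n" "?g n"] B[of n] by simp
  qed
qed

section \<open>Coefficients of the product of theta and Lambert series\<close>

lemma qprod_1: "norm Q < 1 \<Longrightarrow> qprod 1 Q = 0"
  using qprod_rec[of Q 1] by simp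

lemma theta_term_mult: "theta_term Q (a * x) n = theta_term Q a n * x powi n"
  using power_int_mult_distrib[of "- a" x n] by (simp add: theta_term_def)

text \<open>The coefficient of \<open>x powi m\<close> in the product of \<open>theta Q x\<close> with the Lambert series.\<close>

definition lambert_coeff :: "complex \<Rightarrow> complex \<Rightarrow> int \<Rightarrow> complex" where
  "lambert_coeff Q a m = (\<Sum>\<^sub>\<infinity>k. theta_term Q 1 k / (1 - a * Q powi (m - k)))"

lemma lambert_coeff_has_sum:
  fixes a Q :: complex
  assumes a: "norm Q < norm a" "norm a < 1" "Q \<noteq> 0"
  shows "((\<lambda>k. theta_term Q 1 k / (1 - a * Q powi (m - k))) has_sum lambert_coeff Q a m) UNIV"
proof -
  have Q: "norm Q < 1" using a by simp
  obtain \<delta> where \<delta>: "\<delta> > 0" "\<And>n. n \<ge> 0 \<Longrightarrow> norm (1 - a * Q powi n) \<ge> \<delta>"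
    "\<And>n. n < 0 \<Longrightarrow> norm (1 - a * Q powi n) \<ge> \<delta> * norm Q powi n"
    using lambert_denom_lower_bound[OF a] by blast
  \<comment> \<open>Negative powers of \<open>norm Q\<close> are at least 1, so
    \<open>\<delta>\<close> bounds all denominators from below and the theta terms dominate the
    series.\<close>
  have \<delta>': "norm (1 - a * Q powi n) \<ge> \<delta>" for n
  proof (cases "n \<ge> 0")
    case False
    have "\<delta> * 1 \<le> \<delta> * norm Q powi n"
    proof (intro mult_left_mono)
      have "norm Q powi (- n) \<le> 1"
        using False Q by (simp add: power_int_nonneg_exp power_le_one)
      moreover have "norm Q powi n > 0"
        using a(3) by (simp add: zero_less_power_int)
      ultimately show "1 \<le> norm Q powi n"
        by (simp add: power_int_minus field_simps)
    qed (use \<delta> in auto)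
    then show ?thesis using \<delta>(3)[of n] False by simp
  qed (use \<delta> in auto)
  have "(\<lambda>k. norm (theta_term Q 1 k / (1 - a * Q powi (m - k)))) summable_on UNIV"
  proof (rule Infinite_Sum.abs_summable_on_comparison_test')
    show "(\<lambda>k. norm (theta_term Q 1 k) * (1 / \<delta>)) summable_on UNIV"
      by (intro summable_on_cmult_left theta_term_abs_summable) (use a Q in auto)
    show "norm (theta_term Q 1 k / (1 - a * Q powi (m - k))) \<le> norm (theta_term Q 1 k) * (1 / \<delta>)" for k
      using \<delta>(1) \<delta>'[of "m - k"] by (simp add: norm_divide frac_le)
  qed
  then have "(\<lambda>k. theta_term Q 1 k / (1 - a * Q powi (m - k))) summable_on UNIV"
    by (rule Infinite_Sum.abs_summable_summable)
  then show ?thesis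
    unfolding lambert_coeff_def by (rule has_sum_infsum)
qed

text \<open>After an index shift the series for \<open>m + 1\<close> has the same denominators as
  the one for \<open>m\<close>. In the combination \<open>c (m + 1) + a * Q powi m * c m\<close>
  they cancel, leaving the theta series at 1, which vanishes because of the factor
  \<open>1 - 1\<close>.\<close>

lemma lambert_coeff_Suc:
  fixes a Q :: complex
  assumes a: "norm Q < norm a" "norm a < 1" "Q \<noteq> 0"
  shows "lambert_coeff Q a (m + 1) = - a * Q powi m * lambert_coeff Q a m"
proof -
  have Q: "norm Q < 1" using a by simp
  let ?e = "theta_term Q 1"
  have "((\<lambda>k. ?e (k + 1) / (1 - a * Q powi (m + 1 - (k + 1)))) has_sum lambert_coeff Q a (m + 1)) UNIV"
    using lambert_coeff_has_sum[OF a, of "m + 1"]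
    by (subst (asm) has_sum_int_shift[of _ 1, symmetric])
  then have "((\<lambda>k. ?e (k + 1) / (1 - a * Q powi (m + 1 - (k + 1))) +
      a * Q powi m * (?e k / (1 - a * Q powi (m - k)))) has_sum
      lambert_coeff Q a (m + 1) + a * Q powi m * lambert_coeff Q a m) UNIV"
    by (intro has_sum_add has_sum_cmult_right lambert_coeff_has_sum a)
  also have "(\<lambda>k. ?e (k + 1) / (1 - a * Q powi (m + 1 - (k + 1))) +
      a * Q powi m * (?e k / (1 - a * Q powi (m - k)))) = (\<lambda>k. ?e (k + 1))"
  proof
    fix k
    define d where "d = 1 - a * Q powi (m - k)"
    have d: "d \<noteq> 0" unfolding d_def by (rule lambert_denom_nonzero[OF a])
    have s: "?e (k + 1) = - (Q powi k) * ?e k"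
      using theta_term_Suc[of Q 1 k] a(3) by simp
    have "Q powi k * d = Q powi k - a * Q powi m"
      using power_int_add[of Q k "m - k"] a(3) by (simp add: d_def algebra_simps)
    then have "?e (k + 1) + a * Q powi m * ?e k = d * ?e (k + 1)"
      unfolding s by algebra
    then have "?e (k + 1) / d + a * Q powi m * (?e k / d) = ?e (k + 1)"
      using d by (simp add: field_simps)
    then show "?e (k + 1) / (1 - a * Q powi (m + 1 - (k + 1))) +
      a * Q powi m * (?e k / (1 - a * Q powi (m - k))) = ?e (k + 1)"
      by (simp add: d_def)
  qed
  finally have "(?e has_sum lambert_coeff Q a (m + 1) + a * Q powi m * lambert_coeff Q a m) UNIV"
    unfolding has_sum_int_shift .
  moreover have "(?e has_sum theta Q 1) UNIV"
    by (rule has_sum_theta) (use a Q in auto)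
  ultimately have "lambert_coeff Q a (m + 1) + a * Q powi m * lambert_coeff Q a m = theta Q 1"
    by (rule has_sum_unique)
  also have "\<dots> = 0"
    by (simp add: theta_def qprod_1 Q)
  finally show ?thesis
    by (simp add: eq_neg_iff_add_eq_0)
qed

text \<open>Both sides satisfy the same first-order recurrence and agree at 0. Going down is
  possible because the factor \<open>- a * Q powi (m - 1)\<close> is nonzero.\<close>

lemma lambert_coeff_eq:
  fixes a Q :: complex
  assumes a: "norm Q < norm a" "norm a < 1" "Q \<noteq> 0"
  shows "lambert_coeff Q a m = lambert_coeff Q a 0 * theta_term Q a m"
proof (induction m rule: int_induct[where k = 0])
  case base
  show ?case by simp
next
  case (step1 m)
  then show ?case
    using theta_term_Suc[of Q a m] lambert_coeff_Suc[OF a, of m] a by fastforce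
next
  case (step2 m)
  have "a \<noteq> 0" using a by auto
  then have "- a * Q powi (m - 1) * lambert_coeff Q a (m - 1) =
    - a * Q powi (m - 1) * (lambert_coeff Q a 0 * theta_term Q a (m - 1))"
    using theta_term_Suc[of Q a "m - 1"] lambert_coeff_Suc[OF a, of "m - 1"] a(3) step2 by simp
  then show ?case
    using a(3) \<open>a \<noteq> 0\<close> by simp
qed

text \<open>For \<open>norm Q < norm x < 1\<close> both series converge absolutely, so their product
  may be regrouped by the total exponent \<open>m = n + k\<close> of \<open>x\<close>.\<close>

lemma lambert_times_theta:
  fixes a Q x :: complex
  assumes a: "norm Q < norm a" "norm a < 1" "Q \<noteq> 0" and x: "norm Q < norm x" "norm x < 1"
  shows "infsum (lambert_term Q a x) UNIV * theta Q x = lambert_coeff Q a 0 * theta Q (a * x)"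
proof -
  have Q: "norm Q < 1" and nz: "a \<noteq> 0" "x \<noteq> 0" using a x by auto
  have L: "(\<lambda>n. norm (lambert_term Q a x n)) summable_on UNIV"
    by (rule lambert_term_abs_summable[OF a x])
  have "((\<lambda>(n, k). lambert_term Q a x n * theta_term Q x k) has_sum
      infsum (lambert_term Q a x) UNIV * theta Q x) (UNIV \<times> UNIV)"
    by (intro has_sum_times has_sum_infsum Infinite_Sum.abs_summable_summable[OF L] L
        has_sum_theta theta_term_abs_summable a Q nz)
  also have "?this \<longleftrightarrow> ((\<lambda>(m, k). lambert_term Q a x (m - k) * theta_term Q x k) has_sum
      infsum (lambert_term Q a x) UNIV * theta Q x) (UNIV \<times> UNIV)"
    by (rule has_sum_reindex_bij_witness[of _ "\<lambda>(m, k). (m - k, k)" "\<lambda>(n, k). (n + k, k)"]) auto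
  also have "(\<lambda>(m, k). lambert_term Q a x (m - k) * theta_term Q x k) =
      (\<lambda>(m, k). x powi m * (theta_term Q 1 k / (1 - a * Q powi (m - k))))"
    using nz theta_term_mult[of Q 1 x] by (auto simp: lambert_term_def power_int_diff)
  finally have "((\<lambda>m. x powi m * lambert_coeff Q a m) has_sum
      infsum (lambert_term Q a x) UNIV * theta Q x) UNIV"
    by (rule has_sum_SigmaD)
      (simp only: prod.case, intro has_sum_cmult_right lambert_coeff_has_sum a)
  moreover have "(\<lambda>m. x powi m * lambert_coeff Q a m) = (\<lambda>m. lambert_coeff Q a 0 * theta_term Q (a * x) m)"
    by (subst lambert_coeff_eq[OF a]) (simp add: theta_term_mult mult_ac)
  moreover have "((\<lambda>m. lambert_coeff Q a 0 * theta_term Q (a * x) m) has_sum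
      lambert_coeff Q a 0 * theta Q (a * x)) UNIV"
    by (intro has_sum_cmult_right has_sum_theta) (use a Q nz in auto)
  ultimately show ?thesis
    by (metis has_sum_unique)
qed

text \<open>Let \<open>x\<close> tend to 1 through real values below 1 in the product formula. The
  simple pole of the Lambert series, with leading part \<open>1 / (1 - x)\<close>, meets the simple
  zero of \<open>theta Q x\<close>.\<close>

lemma lambert_coeff_0:
  fixes a Q :: complex
  assumes a: "norm Q < norm a" "norm a < 1" "Q \<noteq> 0"
  shows "lambert_coeff Q a 0 * theta Q a = qprod Q Q ^ 3"
proof -
  have Q: "norm Q < 1" and nz: "a \<noteq> 0" using a by auto
  define s where "s = (1 + norm Q) / 2"
  have s: "norm Q < s" "s < 1" using Q by (auto simp: s_def)
  let ?g = "\<lambda>x n. if n \<ge> (0::int) then x powi n else (0::complex)"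
  obtain B where B: "\<And>x n. s \<le> norm x \<Longrightarrow> norm x < 1 \<Longrightarrow>
      norm (lambert_term Q a x n - ?g x n) \<le> B * (norm Q / s) ^ nat \<bar>n\<bar>"
    using lambert_term_minus_geometric_bound[OF a s] by blast
  define M where "M = (\<Sum>\<^sub>\<infinity>n::int. B * (norm Q / s) ^ nat \<bar>n\<bar>)"
  \<comment> \<open>The remainder after removing the geometric series. It is bounded by
    \<open>M\<close> for real \<open>x\<close> between \<open>s\<close> and 1, so it disappears in
    the limit after multiplication by \<open>1 - x\<close>.\<close>
  define R where "R x = (\<Sum>\<^sub>\<infinity>n. lambert_term Q a x n - ?g x n)" for x
  have ev: "\<forall>\<^sub>F t in at_left (1::real). s < t \<and> t < 1"
    using eventually_at_left_real[OF s(2)] by simp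
  have summable: "(\<lambda>n::int. B * (norm Q / s) ^ nat \<bar>n\<bar>) summable_on UNIV"
    using s le_less_trans[OF norm_ge_zero s(1)]
    by (intro summable_on_cmult_right summable_on_geometric_int) (auto simp: divide_simps)
  have R: "norm (R (of_real t)) \<le> M" if "s < t" "t < 1" for t
  proof -
    have "norm (lambert_term Q a (of_real t) n - ?g (of_real t) n) \<le> B * (norm Q / s) ^ nat \<bar>n\<bar>" for n
      using that le_less_trans[OF norm_ge_zero s(1)] by (intro B) auto
    note bound = this
    have "(\<lambda>n. lambert_term Q a (of_real t) n - ?g (of_real t) n) summable_on UNIV"
      using Infinite_Sum.abs_summable_on_comparison_test'[OF summable bound]
      by (rule Infinite_Sum.abs_summable_summable)
    then show ?thesis
      unfolding R_def M_def by (rule norm_infsum_le[OF has_sum_infsum has_sum_infsum[OF summable] bound])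
  qed
  \<comment> \<open>The factor \<open>1 - x\<close> split off from \<open>theta Q x\<close> cancels
    the pole, so every factor on the right has a limit at 1.\<close>
  have key: "lambert_coeff Q a 0 * theta Q (a * of_real t) =
      (1 + (1 - of_real t) * R (of_real t)) *
      (qprod (of_real t * Q) Q * qprod (Q / of_real t) Q * qprod Q Q)"
    if t: "s < t" "t < 1" for t
  proof -
    define x where "x = complex_of_real t"
    have x: "norm Q < norm x" "norm x < 1" and x1: "x \<noteq> 1"
      using t s le_less_trans[OF norm_ge_zero s(1)] by (auto simp: x_def)
    have "(lambert_term Q a x has_sum infsum (lambert_term Q a x) UNIV) UNIV"
      using Infinite_Sum.abs_summable_summable[OF lambert_term_abs_summable[OF a x]] by (rule has_sum_infsum)
    then have "((\<lambda>n. lambert_term Q a x n - ?g x n) has_sum infsum (lambert_term Q a x) UNIV - 1 / (1 - x)) UNIV"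
      using has_sum_add[OF _ has_sum_uminusI[OF has_sum_geometric_int[OF x(2)]]]
      by (simp only: add_uminus_conv_diff)
    then have "R x = infsum (lambert_term Q a x) UNIV - 1 / (1 - x)"
      unfolding R_def by (rule infsumI)
    then have "1 + (1 - x) * R x = (1 - x) * infsum (lambert_term Q a x) UNIV"
      using x1 by (simp add: field_simps)
    moreover have "theta Q x = (1 - x) * (qprod (x * Q) Q * qprod (Q / x) Q * qprod Q Q)"
      using qprod_rec[OF Q, of x] by (simp add: theta_def)
    ultimately show ?thesis
      using lambert_times_theta[OF a x] unfolding x_def [symmetric] by (simp add: mult_ac)
  qed
  have t1: "((\<lambda>t. complex_of_real t) \<longlongrightarrow> 1) (at_left 1)"
    using tendsto_of_real[OF tendsto_ident_at[of 1 "{..<1}"]] by simp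
  have q: "((\<lambda>t. qprod (f t) Q) \<longlongrightarrow> qprod l Q) (at_left (1::real))" if "(f \<longlongrightarrow> l) (at_left 1)" for f l
    using isCont_tendsto_compose[OF isCont_qprod[OF Q] that] .
  have "((\<lambda>t. lambert_coeff Q a 0 * theta Q (a * of_real t)) \<longlongrightarrow> lambert_coeff Q a 0 * theta Q (a * 1)) (at_left 1)"
    unfolding theta_def using nz by (intro tendsto_intros q t1) auto
  moreover have "((\<lambda>t. lambert_coeff Q a 0 * theta Q (a * of_real t)) \<longlongrightarrow>
     (1 + 0) * (qprod (1 * Q) Q * qprod (Q / 1) Q * qprod Q Q)) (at_left 1)"
  proof (rule Lim_transform_eventually)
    have "((\<lambda>t. (1 - of_real t) * R (of_real t)) \<longlongrightarrow> 0) (at_left 1)"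
    proof (rule Lim_null_comparison)
      show "\<forall>\<^sub>F t in at_left 1. norm ((1 - of_real t) * R (of_real t)) \<le> norm (1 - complex_of_real t) * M"
        using ev by eventually_elim (auto simp: norm_mult intro!: mult_left_mono R)
      have "((\<lambda>t. norm (1 - complex_of_real t) * M) \<longlongrightarrow> norm (1 - 1 :: complex) * M) (at_left 1)"
        by (intro tendsto_intros t1)
      then show "((\<lambda>t. norm (1 - complex_of_real t) * M) \<longlongrightarrow> 0) (at_left 1)" by simp
    qed
    then show "((\<lambda>t. (1 + (1 - of_real t) * R (of_real t)) *
      (qprod (of_real t * Q) Q * qprod (Q / of_real t) Q * qprod Q Q)) \<longlongrightarrow>
      (1 + 0) * (qprod (1 * Q) Q * qprod (Q / 1) Q * qprod Q Q)) (at_left 1)"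
      by (intro tendsto_intros q t1) auto
    show "\<forall>\<^sub>F t in at_left 1. (1 + (1 - of_real t) * R (of_real t)) *
      (qprod (of_real t * Q) Q * qprod (Q / of_real t) Q * qprod Q Q) =
      lambert_coeff Q a 0 * theta Q (a * of_real t)"
      using ev by eventually_elim (use key in auto)
  qed
  ultimately have "lambert_coeff Q a 0 * theta Q (a * 1) = (1 + 0) * (qprod (1 * Q) Q * qprod (Q / 1) Q * qprod Q Q)"
    by (rule tendsto_unique[rotated]) simp
  then show ?thesis by (simp add: power3_eq_cube mult_ac)
qed

lemma theta_nonzero:
  assumes "norm Q < 1" "norm Q < norm z" "norm z < 1"
  shows "theta Q z \<noteq> 0"
proof -
  have "z \<noteq> 0" using assms by auto
  then have "norm (Q / z) < 1" using assms by (simp add: norm_divide)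
  then show ?thesis
    using assms by (simp add: theta_def qprod_nonzero_norm)
qed

lemma kronecker_lambert:
  fixes a Q x :: complex
  assumes a: "norm Q < norm a" "norm a < 1" "Q \<noteq> 0" and x: "norm Q < norm x" "norm x < 1"
  shows "(lambert_term Q a x has_sum qprod Q Q ^ 3 * theta Q (a * x) / (theta Q a * theta Q x)) UNIV"
proof -
  have Q: "norm Q < 1" using a by simp
  have nz: "theta Q a \<noteq> 0" "theta Q x \<noteq> 0"
    by (intro theta_nonzero Q a x)+
  have "infsum (lambert_term Q a x) UNIV * theta Q x * theta Q a = qprod Q Q ^ 3 * theta Q (a * x)"
    using lambert_times_theta[OF a x] lambert_coeff_0[OF a] by (metis mult.commute mult.left_commute)
  then have "infsum (lambert_term Q a x) UNIV = qprod Q Q ^ 3 * theta Q (a * x) / (theta Q a * theta Q x)"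
    using nz by (simp add: field_simps)
  then show ?thesis
    using lambert_term_abs_summable[OF a x] by (metis has_sum_infsum Infinite_Sum.abs_summable_summable)
qed

subsection \<open>Products of base \<open>q^10\<close> and \<open>q^20\<close>\<close>

lemma int_triangular: obtains h :: int where "m * (m - 1) = 2 * h" "m * (m - 1) div 2 = h"
proof -
  have "even (m * (m - 1))" by simp
  then obtain h where "m * (m - 1) = 2 * h" by blast
  then show ?thesis using that by simp
qed

text \<open>Separate even and odd indices: with \<open>h = m * (m - 1) div 2\<close>, the exponents
  of \<open>Q\<close> at \<open>2 * m\<close> and \<open>2 * m + 1\<close> are
  \<open>4 * h + m\<close> and \<open>4 * h + 3 * m\<close>. For \<open>Q = - (q ^ 5)\<close> the
  new base is \<open>q ^ 20\<close>.\<close>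

lemma theta_split:
  assumes Q: "Q \<noteq> 0" "norm Q < 1" and z: "z \<noteq> 0"
  shows "theta Q z = theta (Q ^ 4) (- Q * z\<^sup>2) - z * theta (Q ^ 4) (- (Q ^ 3) * z\<^sup>2)"
proof -
  have Q4: "Q ^ 4 \<noteq> 0" "norm (Q ^ 4) < 1"
    using Q by (auto simp: norm_power power_less_one_iff)
  have even: "theta_term Q z (2 * m) = theta_term (Q ^ 4) (- Q * z\<^sup>2) m" for m
  proof -
    obtain h where h: "m * (m - 1) = 2 * h" "m * (m - 1) div 2 = h" by (rule int_triangular)
    have "2 * m * (2 * m - 1) = 2 * (4 * h + m)" using h(1) by (simp add: algebra_simps)
    then have e: "2 * m * (2 * m - 1) div 2 = 4 * h + m" by simp
    show ?thesis
      unfolding theta_term_def e h(2) using Q z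
      by (simp add: power_int_add power_int_mult power_int_mult_distrib)
  qed
  have odd: "theta_term Q z (2 * m + 1) = - z * theta_term (Q ^ 4) (- (Q ^ 3) * z\<^sup>2) m" for m
  proof -
    obtain h where h: "m * (m - 1) = 2 * h" "m * (m - 1) div 2 = h" by (rule int_triangular)
    have "(2 * m + 1) * (2 * m + 1 - 1) = 2 * (4 * h + 3 * m)" using h(1) by (simp add: algebra_simps)
    then have e: "(2 * m + 1) * (2 * m + 1 - 1) div 2 = 4 * h + 3 * m" by simp
    show ?thesis
      unfolding theta_term_def e h(2) using Q z
      by (simp add: power_int_add power_int_mult power_int_mult_distrib)
  qed
  have "(theta_term (Q ^ 4) (- Q * z\<^sup>2) has_sum theta (Q ^ 4) (- Q * z\<^sup>2)) UNIV"
    using Q z by (intro has_sum_theta Q4) auto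
  also have "?this \<longleftrightarrow> (theta_term Q z has_sum theta (Q ^ 4) (- Q * z\<^sup>2)) {n. even n}"
    by (rule has_sum_reindex_bij_witness[of _ "\<lambda>n. n div 2" "\<lambda>m. 2 * m"]) (auto simp: even simp flip: minus_mult_left)
  finally have 1: "(theta_term Q z has_sum theta (Q ^ 4) (- Q * z\<^sup>2)) {n. even n}" .
  have "((\<lambda>m. - z * theta_term (Q ^ 4) (- (Q ^ 3) * z\<^sup>2) m) has_sum - z * theta (Q ^ 4) (- (Q ^ 3) * z\<^sup>2)) UNIV"
    using Q z by (intro has_sum_cmult_right has_sum_theta Q4) auto
  also have "?this \<longleftrightarrow> (theta_term Q z has_sum - z * theta (Q ^ 4) (- (Q ^ 3) * z\<^sup>2)) {n. odd n}"
    by (rule has_sum_reindex_bij_witness[of _ "\<lambda>n. n div 2" "\<lambda>m. 2 * m + 1"]) (auto simp: odd)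
  finally have 2: "(theta_term Q z has_sum - z * theta (Q ^ 4) (- (Q ^ 3) * z\<^sup>2)) {n. odd n}" .
  have "(theta_term Q z has_sum theta (Q ^ 4) (- Q * z\<^sup>2) + - z * theta (Q ^ 4) (- (Q ^ 3) * z\<^sup>2))
      ({n. even n} \<union> {n. odd n})"
    by (rule has_sum_Un_disjoint[OF 1 2]) auto
  also have "{n. even n} \<union> {n. odd n} = (UNIV :: int set)" by auto
  finally show ?thesis
    using has_sum_unique has_sum_theta[OF assms] by fastforce
qed

lemma theta_reflect: "Q \<noteq> 0 \<Longrightarrow> z \<noteq> 0 \<Longrightarrow> theta Q (Q / z) = theta Q z"
  by (simp add: theta_def)

text \<open>Quasi-periodicity: the shift removes the factor \<open>1 - z\<close> from the first
  product and adds \<open>1 - 1 / z\<close> to the second.\<close>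

lemma theta_shift:
  assumes "Q \<noteq> 0" "norm Q < 1" "z \<noteq> 0"
  shows "theta Q (z * Q) = - theta Q z / z"
proof -
  define W where "W = qprod (z * Q) Q * qprod (Q / z) Q * qprod Q Q"
  have "theta Q z = (1 - z) * W"
    using qprod_rec[OF assms(2), of z] by (simp add: theta_def W_def)
  moreover have "theta Q (z * Q) = (1 - 1 / z) * W"
    using qprod_rec[OF assms(2), of "1 / z"] assms by (simp add: theta_def W_def)
  moreover have "(1 - 1 / z) * W * z = - ((1 - z) * W)"
    using assms by (simp add: field_simps)
  ultimately have "theta Q (z * Q) * z = - theta Q z"
    by simp
  then show ?thesis
    using assms by (simp add: field_simps)
qed

text \<open>The exponent \<open>2 * n^2 - n\<close> equals \<open>4 * h + n\<close> with
  \<open>h = n * (n - 1) div 2\<close>, which suggests base \<open>q ^ 4\<close> and argument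
  \<open>- q\<close>.\<close>

lemma psi_eq_theta:
  assumes "q \<noteq> 0" "norm q < 1"
  shows "psi q = theta (q ^ 4) (- q)"
proof -
  have "theta_term (q ^ 4) (- q) n = q powi (2 * n\<^sup>2 - n)" for n
  proof -
    obtain h where h: "n * (n - 1) = 2 * h" "n * (n - 1) div 2 = h" by (rule int_triangular)
    have "2 * n\<^sup>2 - n = 4 * h + n"
      using h(1) by (simp add: power2_eq_square algebra_simps)
    then show ?thesis
      unfolding theta_term_def h(2) using assms by (simp add: power_int_add power_int_mult)
  qed
  then have "theta_term (q ^ 4) (- q) = (\<lambda>n. q powi (2 * n\<^sup>2 - n))" ..
  moreover have "(theta_term (q ^ 4) (- q) has_sum theta (q ^ 4) (- q)) UNIV"
    using assms by (intro has_sum_theta) (auto simp: norm_power power_less_one_iff)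
  ultimately show ?thesis
    unfolding psi_def by (intro infsumI) simp
qed

lemma qprod_split2:
  assumes "norm Q < 1"
  shows "qprod z Q = qprod z (Q\<^sup>2) * qprod (z * Q) (Q\<^sup>2)"
  using qprod_dissect[OF assms, of 2 z] by (simp add: numeral_2_eq_2)

text \<open>Gauss's product for \<open>psi\<close>, cleared of its denominator. Multiplying by
  \<open>(q; q^4)\<close> and \<open>(q^3; q^4)\<close> turns the products at \<open>- q\<close> and
  \<open>- (q ^ 3)\<close> into \<open>(q^2; q^8)\<close> and \<open>(q^6; q^8)\<close>, which make
  up \<open>(q^2; q^4)\<close>.\<close>

lemma psi_product:
  assumes "q \<noteq> 0" "norm q < 1"
  shows "psi q * qprod q (q\<^sup>2) = qprod (q\<^sup>2) (q\<^sup>2)"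
proof -
  have n: "norm (q ^ k) < 1" if "k > 0" for k
    using assms that by (simp add: norm_power power_less_one_iff)
  have "psi q = qprod (- q) (q ^ 4) * qprod (- (q ^ 3)) (q ^ 4) * qprod (q ^ 4) (q ^ 4)"
    using assms by (simp add: psi_eq_theta theta_def eval_nat_numeral)
  moreover have "qprod q (q\<^sup>2) = qprod q (q ^ 4) * qprod (q ^ 3) (q ^ 4)"
    using qprod_split2[OF n[of 2], of q] by (simp add: eval_nat_numeral mult_ac)
  moreover have "qprod q (q ^ 4) * qprod (- q) (q ^ 4) = qprod (q\<^sup>2) (q ^ 8)"
    using qprod_mult_minus[OF n[of 4], of q] by (simp flip: power_mult)
  moreover have "qprod (q ^ 3) (q ^ 4) * qprod (- (q ^ 3)) (q ^ 4) = qprod (q ^ 6) (q ^ 8)"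
    using qprod_mult_minus[OF n[of 4], of "q ^ 3"] by (simp flip: power_mult)
  moreover have "qprod (q\<^sup>2) (q ^ 4) = qprod (q\<^sup>2) (q ^ 8) * qprod (q ^ 6) (q ^ 8)"
    using qprod_split2[OF n[of 4], of "q\<^sup>2"] by (simp flip: power_mult power_add)
  moreover have "qprod (q\<^sup>2) (q\<^sup>2) = qprod (q\<^sup>2) (q ^ 4) * qprod (q ^ 4) (q ^ 4)"
    using qprod_split2[OF n[of 2], of "q\<^sup>2"] by (simp flip: power_mult power_add)
  ultimately show ?thesis
    by (simp add: mult_ac)
qed

lemma psi_0: "psi 0 = 1"
proof -
  have "2 * n\<^sup>2 - n = n * (2 * n - 1)" for n :: int
    by (simp add: power2_eq_square algebra_simps)
  moreover have "2 * n - 1 \<noteq> 0" for n :: int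
    by presburger
  ultimately have "(0::complex) powi (2 * n\<^sup>2 - n) = (if n = 0 then 1 else 0)" for n :: int
    by (simp add: power_int_0_left_if)
  then have "((\<lambda>n::int. (0::complex) powi (2 * n\<^sup>2 - n)) has_sum 1) UNIV"
    by (intro has_sum_finite_neutralI[of "{0}"]) auto
  then show ?thesis
    unfolding psi_def by (rule infsumI)
qed

section \<open>Specialisation to powers of a fixed nonzero \<open>q\<close>\<close>

context
  fixes q :: complex
  assumes q: "q \<noteq> 0" "norm q < 1"
begin

lemma norm_power_q_less_1: "k > 0 \<Longrightarrow> norm (q ^ k) < 1"
  using q by (simp add: norm_power power_less_one_iff)

lemma qprod_power_nonzero: "r > 0 \<Longrightarrow> m > 0 \<Longrightarrow> qprod (q ^ r) (q ^ m) \<noteq> 0"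
  by (intro qprod_nonzero_norm norm_power_q_less_1)

lemma qprod_split_20:
  "qprod (q ^ r) (q ^ 10) = qprod (q ^ r) (q ^ 20) * qprod (q ^ (r + 10)) (q ^ 20)"
  using qprod_split2[OF norm_power_q_less_1[of 10], of "q ^ r"] by (simp add: power_add flip: power_mult)

lemma qprod_mult_minus_20:
  "qprod (q ^ r) (q ^ 10) * qprod (- (q ^ r)) (q ^ 10) = qprod (q ^ (2 * r)) (q ^ 20)"
  using qprod_mult_minus[OF norm_power_q_less_1[of 10], of "q ^ r"] by (simp add: mult.commute flip: power_mult)

lemma theta_20:
  assumes "r < 20"
  shows "theta (q ^ 20) (q ^ r) = qprod (q ^ r) (q ^ 20) * qprod (q ^ (20 - r)) (q ^ 20) * qprod (q ^ 20) (q ^ 20)"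
  using assms q by (simp add: theta_def power_diff)

lemma theta_20_reflect:
  assumes "r < 20"
  shows "theta (q ^ 20) (q ^ (20 - r)) = theta (q ^ 20) (q ^ r)"
  using assms theta_20[of r] theta_reflect[of "q ^ 20" "q ^ r"] q by (simp add: power_diff)

text \<open>Gauss's product for \<open>q\<close>, dissected from base \<open>q^2\<close> into the
  five residue classes of base \<open>q^10\<close>, times Gauss's product for \<open>q^5\<close>,
  which already has base \<open>q^10\<close>. Hence the exponents 5 and 10 occur twice.\<close>

lemma psi_psi_product:
  "psi q * psi (q ^ 5) *
     (qprod q (q ^ 10) * qprod (q ^ 3) (q ^ 10) * qprod (q ^ 5) (q ^ 10) * qprod (q ^ 7) (q ^ 10) * qprod (q ^ 9) (q ^ 10)
      * qprod (q ^ 5) (q ^ 10))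
   = qprod (q ^ 2) (q ^ 10) * qprod (q ^ 4) (q ^ 10) * qprod (q ^ 6) (q ^ 10) * qprod (q ^ 8) (q ^ 10)
      * qprod (q ^ 10) (q ^ 10) * qprod (q ^ 10) (q ^ 10)"
proof -
  have "qprod z (q\<^sup>2) = (\<Prod>i<5. qprod (z * q ^ (2 * i)) (q ^ 10))" for z
    using qprod_dissect[OF norm_power_q_less_1[of 2], of 5 z] by (simp flip: power_mult)
  from this[of q] this[of "q\<^sup>2"] psi_product[OF q]
  have 1: "psi q * (qprod q (q ^ 10) * qprod (q ^ 3) (q ^ 10) * qprod (q ^ 5) (q ^ 10) * qprod (q ^ 7) (q ^ 10) * qprod (q ^ 9) (q ^ 10))
    = qprod (q ^ 2) (q ^ 10) * qprod (q ^ 4) (q ^ 10) * qprod (q ^ 6) (q ^ 10) * qprod (q ^ 8) (q ^ 10) * qprod (q ^ 10) (q ^ 10)"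
    by (simp add: lessThan_nat_numeral lessThan_Suc mult_ac flip: power_add power_Suc numeral_2_eq_2)
  have 2: "psi (q ^ 5) * qprod (q ^ 5) (q ^ 10) = qprod (q ^ 10) (q ^ 10)"
    using psi_product[of "q ^ 5"] q norm_power_q_less_1[of 5] by (simp flip: power_mult)
  show ?thesis
    using arg_cong2[OF 1 2, of "(*)"] by (simp only: mult_ac)
qed

text \<open>Kronecker's formula with \<open>a = q ^ r\<close> and \<open>x = q ^ s\<close>. The
  bounds on \<open>r\<close> and \<open>s\<close> place both points in the annulus between
  \<open>norm (q ^ 20)\<close> and 1.\<close>

lemma kronecker_lambert_20:
  assumes "0 < r" "r < 20" "0 < s" "s < 20"
  shows "((\<lambda>n. q powi (int s * n) / (1 - q powi (20 * n + int r))) has_sum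
    qprod (q ^ 20) (q ^ 20) ^ 3 * theta (q ^ 20) (q ^ (r + s)) /
      (theta (q ^ 20) (q ^ r) * theta (q ^ 20) (q ^ s))) UNIV"
proof -
  have n: "norm (q ^ 20) < norm (q ^ k)" if "k < 20" for k
    unfolding norm_power using q that by (intro power_strict_decreasing) auto
  have "lambert_term (q ^ 20) (q ^ r) (q ^ s) m = q powi (int s * m) / (1 - q powi (20 * m + int r))" for m
    using q by (simp add: lambert_term_def power_int_power power_int_add mult.commute)
  then have "lambert_term (q ^ 20) (q ^ r) (q ^ s) = (\<lambda>n. q powi (int s * n) / (1 - q powi (20 * n + int r)))" ..
  then show ?thesis
    using kronecker_lambert[of "q ^ 20" "q ^ r" "q ^ s"] assms q
    by (simp add: n norm_power_q_less_1 power_add)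
qed

text \<open>Kronecker's formula with \<open>r = 5\<close> and \<open>s = 3, 7\<close>. Since 8 and
  12 are reflections of each other, the two values share a theta factor.\<close>

lemma first_series:
  "((\<lambda>n::int. (q powi (3 * n) + q powi (7 * n + 1)) / (1 - q powi (20 * n + 5)))
      has_sum psi q * psi (q ^ 5)) UNIV"
proof -
  define T U M where "T r = qprod (q ^ r) (q ^ 10)" and "U r = qprod (q ^ r) (q ^ 20)"
    and "M r = qprod (- (q ^ r)) (q ^ 10)" for r
  have TU: "T r = U r * U (r + 10)" and TM: "T r * M r = U (2 * r)" for r
    using qprod_split_20[of r] qprod_mult_minus_20[of r] by (simp_all add: T_def U_def M_def)
  have nz: "T r \<noteq> 0" "U r \<noteq> 0" if "r > 0" for r
    using that by (simp_all add: T_def U_def qprod_power_nonzero)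
  have theta: "theta (q ^ 20) (q ^ r) = U r * U (20 - r) * U 20" if "r < 20" for r
    using theta_20[OF that] by (simp add: U_def)
  have nz_theta: "theta (q ^ 20) (q ^ r) \<noteq> 0" if "0 < r" "r < 20" for r
    using nz that by (simp add: theta)
  let ?\<theta> = "\<lambda>r. theta (q ^ 20) (q ^ r)"
  \<comment> \<open>The odd part of the split has argument \<open>q ^ 17\<close>, which reflects to
    \<open>q ^ 3\<close>.\<close>
  have split: "theta (- (q ^ 5)) (- q) = ?\<theta> 7 + q * ?\<theta> 3"
    using theta_split[of "- (q ^ 5)" "- q"] theta_20_reflect[of 3] q norm_power_q_less_1[of 5]
    by (simp flip: power_mult power_add)
  \<comment> \<open>Each product of base \<open>- (q ^ 5)\<close> separates into two of base
    \<open>q ^ 10\<close>, one at a positive and one at a negative argument.\<close>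
  have prod: "theta (- (q ^ 5)) (- q) = M 1 * T 6 * (T 4 * M 9) * (M 5 * T 10)"
    using qprod_split2[of "- (q ^ 5)"] q norm_power_q_less_1[of 5]
    by (simp add: theta_def T_def M_def flip: power_mult power_add power_Suc)
      (simp add: eval_nat_numeral mult_ac)
  have "((\<lambda>n::int. q powi (3 * n) / (1 - q powi (20 * n + 5)) + q * (q powi (7 * n) / (1 - q powi (20 * n + 5))))
      has_sum U 20 ^ 3 * ?\<theta> 8 / (?\<theta> 5 * ?\<theta> 3) + q * (U 20 ^ 3 * ?\<theta> 12 / (?\<theta> 5 * ?\<theta> 7))) UNIV"
    using kronecker_lambert_20[of 5 3] kronecker_lambert_20[of 5 7] unfolding U_def
    by (intro has_sum_add has_sum_cmult_right) simp_all
  also have "(\<lambda>n::int. q powi (3 * n) / (1 - q powi (20 * n + 5)) + q * (q powi (7 * n) / (1 - q powi (20 * n + 5))))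
    = (\<lambda>n. (q powi (3 * n) + q powi (7 * n + 1)) / (1 - q powi (20 * n + 5)))"
    using q by (simp add: fun_eq_iff power_int_add add_divide_distrib mult.commute)
  also have "U 20 ^ 3 * ?\<theta> 8 / (?\<theta> 5 * ?\<theta> 3) + q * (U 20 ^ 3 * ?\<theta> 12 / (?\<theta> 5 * ?\<theta> 7))
    = U 20 ^ 3 * ?\<theta> 8 * (?\<theta> 7 + q * ?\<theta> 3) / (?\<theta> 5 * ?\<theta> 3 * ?\<theta> 7)"
    using nz_theta[of 3] nz_theta[of 5] nz_theta[of 7] theta_20_reflect[of 8] by (simp add: field_simps)
  \<comment> \<open>The \<open>U\<close> factors of the denominator pair off as
    \<open>U r * U (r + 10) = T r\<close> for \<open>r = 3, 5, 7\<close>, and three copies of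
    \<open>U 20\<close> cancel.\<close>
  also have "\<dots> = U 8 * U 12 * U 20 * (M 1 * T 6 * T 4 * M 9 * M 5 * T 10) / (T 5 * T 3 * T 7)"
    unfolding split [symmetric] prod using nz[of 20] nz[of 3] nz[of 5] nz[of 7] nz[of 13] nz[of 15] nz[of 17]
    by (simp add: theta TU[of 5] TU[of 3] TU[of 7] field_simps power3_eq_cube[of "U 20"])
  also have "\<dots> = psi q * psi (q ^ 5)"
  proof -
    \<comment> \<open>Multiplying by \<open>T 1 * T 9 * T 5\<close> converts \<open>M 1\<close>,
      \<open>M 9\<close>, \<open>M 5\<close> into \<open>U 2\<close>, \<open>U 18\<close>,
      \<open>U 10\<close>. These complete \<open>U 12\<close>, \<open>U 8\<close>,
      \<open>U 20\<close> to products of base \<open>q ^ 10\<close>.\<close>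
    have "U 8 * U 12 * U 20 * (M 1 * T 6 * T 4 * M 9 * M 5 * T 10) * (T 1 * T 9 * T 5)
      = (U 8 * U 18) * (U 2 * U 12) * (U 10 * U 20) * T 6 * T 4 * T 10"
      using TM[of 1] TM[of 9] TM[of 5] by (simp add: mult_ac)
    also have "\<dots> = T 8 * T 2 * T 10 * T 6 * T 4 * T 10"
      by (simp add: TU[of 8] TU[of 2] TU[of 10])
    also have "\<dots> = psi q * psi (q ^ 5) * (T 5 * T 3 * T 7) * (T 1 * T 9 * T 5)"
      using psi_psi_product by (simp add: T_def mult_ac)
    finally show ?thesis
      using nz[of 1] nz[of 3] nz[of 5] nz[of 7] nz[of 9] by (simp add: field_simps)
  qed
  finally show ?thesis .
qed

text \<open>As for the first series, now with \<open>r = 15\<close> and \<open>s = 1, 9\<close>.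
  Here \<open>15 + 9\<close> exceeds 20, and quasi-periodicity supplies the minus sign that the
  split of \<open>theta (- (q ^ 5)) (q^2)\<close> requires.\<close>

lemma second_series:
  "((\<lambda>n::int. (q powi n + q powi (9 * n + 6)) / (1 - q powi (20 * n + 15)))
      has_sum psi q * psi (q ^ 5)) UNIV"
proof -
  define T U M where "T r = qprod (q ^ r) (q ^ 10)" and "U r = qprod (q ^ r) (q ^ 20)"
    and "M r = qprod (- (q ^ r)) (q ^ 10)" for r
  have TU: "T r = U r * U (r + 10)" and TM: "T r * M r = U (2 * r)" for r
    using qprod_split_20[of r] qprod_mult_minus_20[of r] by (simp_all add: T_def U_def M_def)
  have nz: "T r \<noteq> 0" "U r \<noteq> 0" if "r > 0" for r
    using that by (simp_all add: T_def U_def qprod_power_nonzero)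
  have theta: "theta (q ^ 20) (q ^ r) = U r * U (20 - r) * U 20" if "r < 20" for r
    using theta_20[OF that] by (simp add: U_def)
  have nz_theta: "theta (q ^ 20) (q ^ r) \<noteq> 0" if "0 < r" "r < 20" for r
    using nz that by (simp add: theta)
  let ?\<theta> = "\<lambda>r. theta (q ^ 20) (q ^ r)"
  \<comment> \<open>The odd part has argument \<open>q ^ 19\<close>, which reflects to
    \<open>q\<close>.\<close>
  have split: "theta (- (q ^ 5)) (q\<^sup>2) = ?\<theta> 9 - q\<^sup>2 * ?\<theta> 1"
    using theta_split[of "- (q ^ 5)" "q\<^sup>2"] theta_20_reflect[of 1] q norm_power_q_less_1[of 5]
    by (simp flip: power_mult power_add)
  have prod: "theta (- (q ^ 5)) (q\<^sup>2) = T 2 * M 7 * (M 3 * T 8) * (M 5 * T 10)"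
    using qprod_split2[of "- (q ^ 5)"] q norm_power_q_less_1[of 5]
    by (simp add: theta_def T_def M_def flip: power_mult power_add power_Suc)
      (simp add: eval_nat_numeral mult_ac)
  have shift: "q ^ 6 * ?\<theta> 24 = - (q\<^sup>2) * ?\<theta> 4"
  proof -
    have "q ^ 4 * ?\<theta> 24 = - ?\<theta> 4"
      using theta_shift[of "q ^ 20" "q ^ 4"] q norm_power_q_less_1[of 20]
      by (simp add: field_simps flip: power_add)
    moreover have "q ^ 6 = q\<^sup>2 * q ^ 4"
      by (simp flip: power_add)
    ultimately show ?thesis
      by (simp only: mult.assoc) simp
  qed
  have "((\<lambda>n::int. q powi n / (1 - q powi (20 * n + 15)) + q ^ 6 * (q powi (9 * n) / (1 - q powi (20 * n + 15))))
      has_sum U 20 ^ 3 * ?\<theta> 16 / (?\<theta> 15 * ?\<theta> 1) + q ^ 6 * (U 20 ^ 3 * ?\<theta> 24 / (?\<theta> 15 * ?\<theta> 9))) UNIV"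
    using kronecker_lambert_20[of 15 1] kronecker_lambert_20[of 15 9] unfolding U_def
    by (intro has_sum_add has_sum_cmult_right) simp_all
  also have "(\<lambda>n::int. q powi n / (1 - q powi (20 * n + 15)) + q ^ 6 * (q powi (9 * n) / (1 - q powi (20 * n + 15))))
    = (\<lambda>n. (q powi n + q powi (9 * n + 6)) / (1 - q powi (20 * n + 15)))"
    using q by (simp add: fun_eq_iff power_int_add add_divide_distrib mult.commute)
  also have "U 20 ^ 3 * ?\<theta> 16 / (?\<theta> 15 * ?\<theta> 1) + q ^ 6 * (U 20 ^ 3 * ?\<theta> 24 / (?\<theta> 15 * ?\<theta> 9))
    = U 20 ^ 3 * ?\<theta> 16 / (?\<theta> 15 * ?\<theta> 1) + U 20 ^ 3 * (q ^ 6 * ?\<theta> 24) / (?\<theta> 15 * ?\<theta> 9)"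
    by simp
  also have "\<dots> = U 20 ^ 3 * ?\<theta> 4 * (?\<theta> 9 - q\<^sup>2 * ?\<theta> 1) / (?\<theta> 15 * ?\<theta> 1 * ?\<theta> 9)"
    unfolding shift using nz_theta[of 1] nz_theta[of 9] nz_theta[of 15] theta_20_reflect[of 4] by (simp add: field_simps)
  also have "\<dots> = U 4 * U 16 * U 20 * (T 2 * M 7 * M 3 * T 8 * M 5 * T 10) / (T 5 * T 1 * T 9)"
    unfolding split [symmetric] prod using nz[of 20] nz[of 1] nz[of 5] nz[of 9] nz[of 11] nz[of 15] nz[of 19]
    by (simp add: theta theta[of 1, simplified] TU[of 5] TU[of 1, simplified] TU[of 9] field_simps power3_eq_cube[of "U 20"])
  also have "\<dots> = psi q * psi (q ^ 5)"
  proof -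
    \<comment> \<open>The multiplier \<open>T 3 * T 7 * T 5\<close> now absorbs \<open>M 3\<close>,
      \<open>M 7\<close>, \<open>M 5\<close>, producing the partners \<open>U 6\<close>,
      \<open>U 14\<close>, \<open>U 10\<close> of \<open>U 16\<close>, \<open>U 4\<close>,
      \<open>U 20\<close>.\<close>
    have "U 4 * U 16 * U 20 * (T 2 * M 7 * M 3 * T 8 * M 5 * T 10) * (T 3 * T 7 * T 5)
      = (U 4 * U 14) * (U 6 * U 16) * (U 10 * U 20) * T 2 * T 8 * T 10"
    proof -
      have "U 6 = T 3 * M 3" "U 14 = T 7 * M 7" "U 10 = T 5 * M 5"
        using TM[of 3] TM[of 7] TM[of 5] by simp_all
      then show ?thesis by (simp only: mult_ac)
    qed
    also have "\<dots> = T 4 * T 6 * T 10 * T 2 * T 8 * T 10"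
      by (simp add: TU[of 4] TU[of 6] TU[of 10])
    also have "\<dots> = psi q * psi (q ^ 5) * (T 5 * T 1 * T 9) * (T 3 * T 7 * T 5)"
      using psi_psi_product by (simp add: T_def mult_ac)
    finally show ?thesis
      using nz[of 1] nz[of 3] nz[of 5] nz[of 7] nz[of 9] by (simp add: field_simps)
  qed
  finally show ?thesis .
qed

end

theorem theorem3p5:
  fixes q :: complex
  assumes "norm q < 1"
  shows "((\<lambda>n::int. (q powi (3 * n) + q powi (7 * n + 1)) / (1 - q powi (20 * n + 5)))
           has_sum (psi q * psi (q ^ 5))) UNIV
       \<and> ((\<lambda>n::int. (q powi n + q powi (9 * n + 6)) / (1 - q powi (20 * n + 15)))
           has_sum (psi q * psi (q ^ 5))) UNIV"
proof (cases "q = 0")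
  case True
  \<comment> \<open>At \<open>q = 0\<close> every power with a nonzero exponent of either sign is 0,
    so each series reduces to the value 1 at \<open>n = 0\<close>.\<close>
  have "3 * n = 0 \<longleftrightarrow> n = 0" "7 * n + 1 \<noteq> 0" "20 * n + 5 \<noteq> 0" "9 * n + 6 \<noteq> 0" "20 * n + 15 \<noteq> 0" for n :: int
    by presburger+
  then show ?thesis
    unfolding True
    by (intro conjI has_sum_finite_neutralI[of "{0}"]) (simp_all add: psi_0 power_int_0_left_if)
next
  case False
  then show ?thesis
    using first_series second_series assms by blast
qed

end
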